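(* Let $R$ be a ring, $\theta\in\mathrm{Aut}(R)$, $n\ge 1$, and let $C$ be a subset of $R^n$. With the notation of the context, we have: (1) ${}^{\perp *}C$ is always an $R$-submodule of $R^n$ and $C^{*\perp}$ is always an additive subgroup of $R^n$. (2) For $x,y\in R^n$, we have $x*y^t=x\cdot\varphi(y)$, where $\cdot$ stands for the usual dot product. (3) $C\subseteq {}^{\perp *}(C^{*\perp})$ and $C\subseteq({}^{\perp *}C^t)^{*\perp}$. (3$'$) $C\subseteq {}^{\perp\circ}(C^{\circ\perp})$ and $C\subseteq({}^{\perp\circ}C^t)^{\circ\perp}$. (4) ${}^{\perp *}C=\varphi(C^t)^{\perp}$ and $C^{\perp}=\varphi(C^{*\perp})$. (4$'$) ${}^{\perp\circ}C=\varphi(C^t)^{\perp}$ and $C^{\perp}=\varphi(C^{\circ\perp})$.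
   Context: $R$ is a ring with unity and $\mathrm{Aut}(R)$ is its group of ring automorphisms. $R^n$ is the space of rows of length $n$ over $R$, $x^t$ is the column that is the transpose of the row $x$, and $C^t=\{c^t: c\in C\}$. Rows and columns are identified by transposition where needed; in particular ${}^{\perp *}C^t$ and ${}^{\perp\circ}C^t$ mean ${}^{\perp *}C$ and ${}^{\perp\circ}C$. For $b=(b_1,\dots,b_n)\in R^n$, $\varphi(b^t)=(b_1,\theta(b_2),\dots,\theta^{n-1}(b_n))^t$, and $\varphi(b)$ denotes the same vector. For $a,b\in R^n$, $a\cdot b=\sum_r a_rb_r$ is the usual dot product, and $$a*b^t=\sum_{r=1}^n a_r\theta^{r-1}(b_r),\qquad a\circ b^t=\sum_{r=1}^n a_r\theta^{1-r}(b_r).$$ For $C\subseteq R^n$: ${}^{\perp *}C=\{x\in R^n: x*c^t=0\ \forall c\in C\}$, $C^{*\perp}=\{x\in R^n: c*x^t=0\ \forall c\in C\}$, ${}^{\perp\circ}C=\{x\in R^n: x\circ c^t=0\ \forall c\in C\}$, $C^{\circ\perp}=\{x\in R^n: c\circ x^t=0\ \forall c\in C\}$. The superscript $\perp$ alone denotes the orthogonal for the usual dot product: for a set $D$ of rows, $D^{\perp}$ is the set of vectors $y$ with $d\cdot y=0$ for all $d\in D$; for a set $D$ of columns, $D^{\perp}$ is the set of rows $x$ with $x\cdot d=0$ for all $d\in D$.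
   Formalization: Item (4') is false as printed when θ² is not the identity and n ≥ 2; it is proved with φ replaced by the map belonging to θ⁻¹, b ↦ (b_1, θ^{-1}(b_2), …, θ^{1-n}(b_n)). *)

theory Defs
  imports "HOL-Algebra.Bij" "HOL-Algebra.QuotRing" "HOL-Algebra.Module"
begin

text \<open>
  Automorphisms are taken extensional (value \<open>undefined\<close> off the carrier), so that each
  automorphism is represented by exactly one function and they form a group under the
  composition of \<^const>\<open>BijGroup\<close>. Integer powers \<open>\<theta>\<^sup>k\<close> are taken in this group.
\<close>

definition ring_auto :: "('a, 'm) ring_scheme \<Rightarrow> ('a \<Rightarrow> 'a) set"
  where "ring_auto R = ring_iso R R \<inter> extensional (carrier R)"

definition RingAut :: "('a, 'm) ring_scheme \<Rightarrow> ('a \<Rightarrow> 'a) monoid"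
  where "RingAut R = BijGroup (carrier R) \<lparr>carrier := ring_auto R\<rparr>"

lemma group_RingAut:
  assumes "ring R"
  shows "group (RingAut R)"
proof -
  interpret ring R by fact
  interpret B: group "BijGroup (carrier R)" by (rule group_BijGroup)
  have sub: "ring_auto R \<subseteq> Bij (carrier R)"
    by (auto simp: ring_auto_def ring_iso_def Bij_def)
  have "subgroup (ring_auto R) (BijGroup (carrier R))"
  proof (rule B.subgroupI)
    show "ring_auto R \<subseteq> carrier (BijGroup (carrier R))"
      using sub by (simp add: BijGroup_def)
    have "(\<lambda>x\<in>carrier R. x) \<in> ring_auto R"
      by (auto simp: ring_auto_def ring_iso_def ring_hom_def bij_betw_def inj_on_def)
    then show "ring_auto R \<noteq> {}" by blast
  next
    fix f assume f: "f \<in> ring_auto R"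
    then have fB: "f \<in> Bij (carrier R)" and fi: "f \<in> ring_iso R R"
      using sub by (auto simp: ring_auto_def)
    have "inv_into (carrier R) f \<in> ring_iso R R"
      using ring_iso_set_sym[OF ring_axioms fi] by simp
    then have "(\<lambda>x\<in>carrier R. inv_into (carrier R) f x) \<in> ring_iso R R"
      by (auto simp: ring_iso_def ring_hom_def bij_betw_def inj_on_def)
    then show "inv\<^bsub>BijGroup (carrier R)\<^esub> f \<in> ring_auto R"
      by (simp add: inv_BijGroup[OF fB] ring_auto_def)
  next
    fix f g assume "f \<in> ring_auto R" and "g \<in> ring_auto R"
    moreover from this have "compose (carrier R) f g \<in> ring_iso R R"
      using sub compose_Bij[of f "carrier R" g]
      by (auto simp: ring_auto_def ring_iso_def ring_hom_def Bij_def compose_def Pi_iff)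
    ultimately show "f \<otimes>\<^bsub>BijGroup (carrier R)\<^esub> g \<in> ring_auto R"
      using sub by (auto simp: BijGroup_def ring_auto_def)
  qed
  then show ?thesis
    unfolding RingAut_def by (rule B.subgroup_imp_group)
qed

text \<open>
  A row and its transpose are the same object: an extensional function on \<open>{1..n}\<close>.
  The left \<open>R\<close>-module \<open>R\<^sup>n\<close> is given as a record because the library's \<^locale>\<open>module\<close>
  demands a commutative ring; \<^locale>\<open>submodule\<close> does not, and with \<open>smult\<close> being
  multiplication by scalars from the left it is the notion of a left submodule. The \<open>mult\<close> and
  \<open>one\<close> fields are required by the record type only.
\<close>

definition row_module :: "('a, 'm) ring_scheme \<Rightarrow> nat \<Rightarrow> ('a, nat \<Rightarrow> 'a) module"
  where "row_module R n =
    \<lparr>carrier = {1..n} \<rightarrow>\<^sub>E carrier R,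
     mult = (\<lambda>x y. \<lambda>r\<in>{1..n}. x r \<otimes>\<^bsub>R\<^esub> y r),
     one = (\<lambda>r\<in>{1..n}. \<one>\<^bsub>R\<^esub>),
     zero = (\<lambda>r\<in>{1..n}. \<zero>\<^bsub>R\<^esub>),
     add = (\<lambda>x y. \<lambda>r\<in>{1..n}. x r \<oplus>\<^bsub>R\<^esub> y r),
     smult = (\<lambda>a x. \<lambda>r\<in>{1..n}. a \<otimes>\<^bsub>R\<^esub> x r)\<rparr>"

abbreviation rows :: "('a, 'm) ring_scheme \<Rightarrow> nat \<Rightarrow> (nat \<Rightarrow> 'a) set"
  where "rows R n \<equiv> carrier (row_module R n)"

lemma abelian_group_row_module:
  assumes "ring R"
  shows "abelian_group (row_module R n)"
proof -
  interpret ring R by fact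
  show ?thesis
  proof (rule abelian_groupI)
    fix x assume x: "x \<in> rows R n"
    let ?y = "\<lambda>r\<in>{1..n}. \<ominus>\<^bsub>R\<^esub> x r"
    have "?y \<in> rows R n" and "?y \<oplus>\<^bsub>row_module R n\<^esub> x = \<zero>\<^bsub>row_module R n\<^esub>"
      using x by (auto simp: row_module_def PiE_iff l_neg intro!: restrict_ext)
    then show "\<exists>y\<in>rows R n. y \<oplus>\<^bsub>row_module R n\<^esub> x = \<zero>\<^bsub>row_module R n\<^esub>"
      by blast
  qed (auto simp: row_module_def PiE_iff a_ac fun_eq_iff extensional_def)
qed

definition phi :: "('a, 'm) ring_scheme \<Rightarrow> nat \<Rightarrow> ('a \<Rightarrow> 'a) \<Rightarrow> (nat \<Rightarrow> 'a) \<Rightarrow> nat \<Rightarrow> 'a"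
  where "phi R n \<theta> b = (\<lambda>r\<in>{1..n}. (\<theta> [^]\<^bsub>RingAut R\<^esub> (int r - 1)) (b r))"

definition dot :: "('a, 'm) ring_scheme \<Rightarrow> nat \<Rightarrow> (nat \<Rightarrow> 'a) \<Rightarrow> (nat \<Rightarrow> 'a) \<Rightarrow> 'a"
  where "dot R n a b = (\<Oplus>\<^bsub>R\<^esub>r\<in>{1..n}. a r \<otimes>\<^bsub>R\<^esub> b r)"

definition star :: "('a, 'm) ring_scheme \<Rightarrow> nat \<Rightarrow> ('a \<Rightarrow> 'a) \<Rightarrow> (nat \<Rightarrow> 'a) \<Rightarrow> (nat \<Rightarrow> 'a) \<Rightarrow> 'a"
  where "star R n \<theta> a b =
    (\<Oplus>\<^bsub>R\<^esub>r\<in>{1..n}. a r \<otimes>\<^bsub>R\<^esub> (\<theta> [^]\<^bsub>RingAut R\<^esub> (int r - 1)) (b r))"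

definition circ :: "('a, 'm) ring_scheme \<Rightarrow> nat \<Rightarrow> ('a \<Rightarrow> 'a) \<Rightarrow> (nat \<Rightarrow> 'a) \<Rightarrow> (nat \<Rightarrow> 'a) \<Rightarrow> 'a"
  where "circ R n \<theta> a b =
    (\<Oplus>\<^bsub>R\<^esub>r\<in>{1..n}. a r \<otimes>\<^bsub>R\<^esub> (\<theta> [^]\<^bsub>RingAut R\<^esub> (1 - int r)) (b r))"

definition left_star_perp ::
    "('a, 'm) ring_scheme \<Rightarrow> nat \<Rightarrow> ('a \<Rightarrow> 'a) \<Rightarrow> (nat \<Rightarrow> 'a) set \<Rightarrow> (nat \<Rightarrow> 'a) set"
  where "left_star_perp R n \<theta> C = {x \<in> rows R n. \<forall>c\<in>C. star R n \<theta> x c = \<zero>\<^bsub>R\<^esub>}"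

definition right_star_perp ::
    "('a, 'm) ring_scheme \<Rightarrow> nat \<Rightarrow> ('a \<Rightarrow> 'a) \<Rightarrow> (nat \<Rightarrow> 'a) set \<Rightarrow> (nat \<Rightarrow> 'a) set"
  where "right_star_perp R n \<theta> C = {x \<in> rows R n. \<forall>c\<in>C. star R n \<theta> c x = \<zero>\<^bsub>R\<^esub>}"

definition left_circ_perp ::
    "('a, 'm) ring_scheme \<Rightarrow> nat \<Rightarrow> ('a \<Rightarrow> 'a) \<Rightarrow> (nat \<Rightarrow> 'a) set \<Rightarrow> (nat \<Rightarrow> 'a) set"
  where "left_circ_perp R n \<theta> C = {x \<in> rows R n. \<forall>c\<in>C. circ R n \<theta> x c = \<zero>\<^bsub>R\<^esub>}"

definition right_circ_perp ::
    "('a, 'm) ring_scheme \<Rightarrow> nat \<Rightarrow> ('a \<Rightarrow> 'a) \<Rightarrow> (nat \<Rightarrow> 'a) set \<Rightarrow> (nat \<Rightarrow> 'a) set"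
  where "right_circ_perp R n \<theta> C = {x \<in> rows R n. \<forall>c\<in>C. circ R n \<theta> c x = \<zero>\<^bsub>R\<^esub>}"

text \<open>
  The orthogonal \<open>D\<^sup>\<bottom>\<close> for the dot product depends on whether \<open>D\<close> consists of rows (then it is
  the left factor) or of columns (then it is the right factor). As rows and columns are
  identified here, the two readings are separate constants.
\<close>

definition perp_of_rows :: "('a, 'm) ring_scheme \<Rightarrow> nat \<Rightarrow> (nat \<Rightarrow> 'a) set \<Rightarrow> (nat \<Rightarrow> 'a) set"
  where "perp_of_rows R n D = {y \<in> rows R n. \<forall>d\<in>D. dot R n d y = \<zero>\<^bsub>R\<^esub>}"

definition perp_of_columns :: "('a, 'm) ring_scheme \<Rightarrow> nat \<Rightarrow> (nat \<Rightarrow> 'a) set \<Rightarrow> (nat \<Rightarrow> 'a) set"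
  where "perp_of_columns R n D = {x \<in> rows R n. \<forall>d\<in>D. dot R n x d = \<zero>\<^bsub>R\<^esub>}"

end

theory Submission
  imports Defs
begin

text \<open>
  Everything rests on one observation: \<open>x * y = x \<cdot> \<phi>(y)\<close>, and
  \<open>\<phi>\<close>, acting on the \<open>r\<close>-th coordinate by the automorphism
  \<open>\<theta>\<^sup>r\<^sup>-\<^sup>1\<close>, is an additive bijection of the rows whose
  inverse is the map \<open>\<phi>\<close> of \<open>\<theta>\<^sup>-\<^sup>1\<close>. So
  \<open>*\<close> is the dot product with its right factor twisted by \<open>\<phi>\<close>. It
  is additive in both arguments, which makes both orthogonals intersections of kernels of additive
  maps, hence additive subgroups. In the first argument it is moreover left homogeneous, so the
  left orthogonal is a submodule. In the second argument a left scalar reaches the sum only after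
  \<open>\<phi>\<close> has changed it, and then stands between two factors that need not commute
  with it; this is why the right orthogonal is in general only a subgroup. The twist turns
  orthogonality for \<open>*\<close> into orthogonality for the dot product, and surjectivity of
  \<open>\<phi>\<close> is what gives equality in \<open>C\<^sup>\<bottom> =
  \<phi>(C\<^sup>*\<^sup>\<bottom>)\<close>. The inclusions of \<open>C\<close> in its double
  orthogonals are the formal half of the Galois connection of a binary relation.

  The statements about \<open>\<circ>\<close> are instances of those about \<open>*\<close>: the
  identity \<open>(\<theta>\<^sup>-\<^sup>1)\<^sup>r\<^sup>-\<^sup>1 =
  \<theta>\<^sup>1\<^sup>-\<^sup>r\<close> shows that \<open>\<circ>\<close> for
  \<open>\<theta>\<close> is \<open>*\<close> for \<open>\<theta>\<^sup>-\<^sup>1\<close>.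
\<close>

lemma rows_nth_closed:
  assumes "x \<in> rows R n" and "r \<in> {1..n}"
  shows "x r \<in> carrier R"
  using assms by (auto simp: row_module_def)

lemma RingAut_ring_hom:
  assumes "f \<in> carrier (RingAut R)"
  shows "f \<in> ring_hom R R"
  using assms by (simp add: RingAut_def ring_auto_def ring_iso_def)

lemma RingAut_mult_apply:
  assumes "f \<in> carrier (RingAut R)" and "g \<in> carrier (RingAut R)" and "a \<in> carrier R"
  shows "(f \<otimes>\<^bsub>RingAut R\<^esub> g) a = f (g a)"
proof -
  have "carrier (RingAut R) \<subseteq> Bij (carrier R)"
    by (auto simp: RingAut_def ring_auto_def ring_iso_def Bij_def)
  then show ?thesis
    using assms by (auto simp: RingAut_def BijGroup_def compose_def)
qed

lemma RingAut_one_apply: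
  assumes "a \<in> carrier R"
  shows "\<one>\<^bsub>RingAut R\<^esub> a = a"
  using assms by (simp add: RingAut_def BijGroup_def)

context ring
begin

lemma RingAut_int_pow_ring_hom:
  assumes "\<theta> \<in> carrier (RingAut R)"
  shows "\<theta> [^]\<^bsub>RingAut R\<^esub> (k::int) \<in> ring_hom R R"
proof -
  interpret A: group "RingAut R" by (rule group_RingAut) (rule ring_axioms)
  show ?thesis using assms by (intro RingAut_ring_hom A.int_pow_closed)
qed

lemma phi_closed:
  assumes "\<theta> \<in> carrier (RingAut R)" and "x \<in> rows R n"
  shows "phi R n \<theta> x \<in> rows R n"
  using ring_hom_closed[OF RingAut_int_pow_ring_hom[OF assms(1)]] rows_nth_closed[OF assms(2)]
  by (simp add: phi_def row_module_def)

lemma phi_add: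
  assumes "\<theta> \<in> carrier (RingAut R)" and "x \<in> rows R n" and "y \<in> rows R n"
  shows "phi R n \<theta> (x \<oplus>\<^bsub>row_module R n\<^esub> y) = phi R n \<theta> x \<oplus>\<^bsub>row_module R n\<^esub> phi R n \<theta> y"
  using ring_hom_add[OF RingAut_int_pow_ring_hom[OF assms(1)]]
    rows_nth_closed[OF assms(2)] rows_nth_closed[OF assms(3)]
  by (auto simp: phi_def row_module_def)

lemma RingAut_inv_int_pow:
  assumes "\<theta> \<in> carrier (RingAut R)"
  shows "inv\<^bsub>RingAut R\<^esub> \<theta> [^]\<^bsub>RingAut R\<^esub> (k::int) = \<theta> [^]\<^bsub>RingAut R\<^esub> (- k)"
proof -
  interpret A: group "RingAut R" by (rule group_RingAut) (rule ring_axioms)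
  show ?thesis using assms by (simp add: A.int_pow_inv A.int_pow_neg)
qed

text \<open>
  Coordinatewise this is \<open>\<theta>\<^sup>k (\<theta>\<^sup>-\<^sup>k a) = a\<close>; it supplies the preimages that make \<open>\<phi>\<close> onto.
\<close>

lemma phi_phi_inv:
  assumes \<theta>: "\<theta> \<in> carrier (RingAut R)" and x: "x \<in> rows R n"
  shows "phi R n \<theta> (phi R n (inv\<^bsub>RingAut R\<^esub> \<theta>) x) = x"
proof
  interpret A: group "RingAut R" by (rule group_RingAut) (rule ring_axioms)
  fix r
  show "phi R n \<theta> (phi R n (inv\<^bsub>RingAut R\<^esub> \<theta>) x) r = x r"
  proof (cases "r \<in> {1..n}")
    case True
    define k where "k = int r - 1"
    have "(\<theta> [^]\<^bsub>RingAut R\<^esub> k) ((\<theta> [^]\<^bsub>RingAut R\<^esub> (- k)) (x r))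
        = (\<theta> [^]\<^bsub>RingAut R\<^esub> k \<otimes>\<^bsub>RingAut R\<^esub> \<theta> [^]\<^bsub>RingAut R\<^esub> (- k)) (x r)"
      using \<theta> rows_nth_closed[OF x True] by (simp add: RingAut_mult_apply)
    also have "\<theta> [^]\<^bsub>RingAut R\<^esub> k \<otimes>\<^bsub>RingAut R\<^esub> \<theta> [^]\<^bsub>RingAut R\<^esub> (- k) = \<one>\<^bsub>RingAut R\<^esub>"
      using \<theta> by (simp add: A.int_pow_neg)
    finally have "(\<theta> [^]\<^bsub>RingAut R\<^esub> k) ((\<theta> [^]\<^bsub>RingAut R\<^esub> (- k)) (x r)) = x r"
      using rows_nth_closed[OF x True] by (simp add: RingAut_one_apply)
    then show ?thesis
      using True unfolding phi_def RingAut_inv_int_pow[OF \<theta>] k_def by simp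
  next
    case False
    then show ?thesis
      using x by (auto simp: phi_def row_module_def PiE_def extensional_def)
  qed
qed

lemma dot_closed:
  assumes "x \<in> rows R n" and "y \<in> rows R n"
  shows "dot R n x y \<in> carrier R"
  unfolding dot_def using rows_nth_closed[OF assms(1)] rows_nth_closed[OF assms(2)]
  by (intro finsum_closed) auto

lemma dot_add_left:
  assumes "x \<in> rows R n" and "x' \<in> rows R n" and "y \<in> rows R n"
  shows "dot R n (x \<oplus>\<^bsub>row_module R n\<^esub> x') y = dot R n x y \<oplus> dot R n x' y"
proof -
  note nth = rows_nth_closed[OF assms(1)] rows_nth_closed[OF assms(2)] rows_nth_closed[OF assms(3)]
  have "dot R n (x \<oplus>\<^bsub>row_module R n\<^esub> x') y = (\<Oplus>r\<in>{1..n}. x r \<otimes> y r \<oplus> x' r \<otimes> y r)"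
    unfolding dot_def using nth by (intro finsum_cong') (auto simp: row_module_def l_distr)
  also have "\<dots> = dot R n x y \<oplus> dot R n x' y"
    unfolding dot_def using nth by (intro finsum_addf) auto
  finally show ?thesis .
qed

lemma dot_add_right:
  assumes "x \<in> rows R n" and "y \<in> rows R n" and "y' \<in> rows R n"
  shows "dot R n x (y \<oplus>\<^bsub>row_module R n\<^esub> y') = dot R n x y \<oplus> dot R n x y'"
proof -
  note nth = rows_nth_closed[OF assms(1)] rows_nth_closed[OF assms(2)] rows_nth_closed[OF assms(3)]
  have "dot R n x (y \<oplus>\<^bsub>row_module R n\<^esub> y') = (\<Oplus>r\<in>{1..n}. x r \<otimes> y r \<oplus> x r \<otimes> y' r)"
    unfolding dot_def using nth by (intro finsum_cong') (auto simp: row_module_def r_distr)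
  also have "\<dots> = dot R n x y \<oplus> dot R n x y'"
    unfolding dot_def using nth by (intro finsum_addf) auto
  finally show ?thesis .
qed

lemma dot_smult_left:
  assumes "a \<in> carrier R" and "x \<in> rows R n" and "y \<in> rows R n"
  shows "dot R n (a \<odot>\<^bsub>row_module R n\<^esub> x) y = a \<otimes> dot R n x y"
proof -
  note nth = rows_nth_closed[OF assms(2)] rows_nth_closed[OF assms(3)]
  have "dot R n (a \<odot>\<^bsub>row_module R n\<^esub> x) y = (\<Oplus>r\<in>{1..n}. a \<otimes> (x r \<otimes> y r))"
    unfolding dot_def using assms(1) nth
    by (intro finsum_cong') (auto simp: row_module_def m_assoc)
  also have "\<dots> = a \<otimes> dot R n x y"
    unfolding dot_def using assms(1) nth by (intro finsum_rdistr[symmetric]) auto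
  finally show ?thesis .
qed

lemma star_eq_dot_phi:
  assumes "\<theta> \<in> carrier (RingAut R)" and "x \<in> rows R n" and "y \<in> rows R n"
  shows "star R n \<theta> x y = dot R n x (phi R n \<theta> y)"
  unfolding star_def dot_def
  using rows_nth_closed[OF assms(2)] rows_nth_closed[OF phi_closed[OF assms(1,3)]]
  by (intro finsum_cong') (auto simp: phi_def)

lemma circ_eq_star_inv:
  assumes "\<theta> \<in> carrier (RingAut R)"
  shows "circ R n \<theta> = star R n (inv\<^bsub>RingAut R\<^esub> \<theta>)"
  by (simp add: circ_def star_def RingAut_inv_int_pow[OF assms] fun_eq_iff)

text \<open>
  The set is the intersection of the kernels of the additive maps \<open>h c\<close>; for empty \<open>C\<close> it is
  the group of all rows.
\<close>

lemma subgroup_common_kernel: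
  assumes closed: "\<And>c x. c \<in> C \<Longrightarrow> x \<in> rows R n \<Longrightarrow> h c x \<in> carrier R"
    and add: "\<And>c x y. c \<in> C \<Longrightarrow> x \<in> rows R n \<Longrightarrow> y \<in> rows R n \<Longrightarrow>
      h c (x \<oplus>\<^bsub>row_module R n\<^esub> y) = h c x \<oplus> h c y"
  shows "subgroup {x \<in> rows R n. \<forall>c\<in>C. h c x = \<zero>} (add_monoid (row_module R n))"
proof -
  interpret M: abelian_group "row_module R n"
    by (rule abelian_group_row_module) (rule ring_axioms)
  have hom: "group_hom (add_monoid (row_module R n)) (add_monoid R) (h c)" if "c \<in> C" for c
    using closed[OF that] add[OF that]
    by (intro group_hom.intro group_hom_axioms.intro M.a_group a_group homI) auto
  have zero: "h c \<zero>\<^bsub>row_module R n\<^esub> = \<zero>" if "c \<in> C" for c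
    using group_hom.hom_one[OF hom[OF that]] by simp
  have minus: "h c (\<ominus>\<^bsub>row_module R n\<^esub> x) = \<ominus> h c x" if "c \<in> C" "x \<in> rows R n" for c x
    using group_hom.hom_inv[OF hom[OF that(1)], of x] that(2) by (simp add: a_inv_def)
  show ?thesis
  proof (rule group.subgroupI[OF M.a_group])
    show "{x \<in> rows R n. \<forall>c\<in>C. h c x = \<zero>} \<noteq> {}"
      using zero M.zero_closed by blast
  next
    fix x assume "x \<in> {x \<in> rows R n. \<forall>c\<in>C. h c x = \<zero>}"
    then show "inv\<^bsub>add_monoid (row_module R n)\<^esub> x \<in> {x \<in> rows R n. \<forall>c\<in>C. h c x = \<zero>}"
      using minus by (simp flip: a_inv_def)
  qed (auto simp: add)
qed

lemma subgroup_left_star_perp: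
  assumes \<theta>: "\<theta> \<in> carrier (RingAut R)" and C: "C \<subseteq> rows R n"
  shows "subgroup (left_star_perp R n \<theta> C) (add_monoid (row_module R n))"
proof -
  interpret M: abelian_group "row_module R n"
    by (rule abelian_group_row_module) (rule ring_axioms)
  show ?thesis
    unfolding left_star_perp_def using C
    by (intro subgroup_common_kernel)
      (auto simp: subset_iff star_eq_dot_phi[OF \<theta>] phi_closed[OF \<theta>] dot_closed dot_add_left)
qed

lemma smult_closed_left_star_perp:
  assumes \<theta>: "\<theta> \<in> carrier (RingAut R)" and C: "C \<subseteq> rows R n"
    and a: "a \<in> carrier R" and x: "x \<in> left_star_perp R n \<theta> C"
  shows "a \<odot>\<^bsub>row_module R n\<^esub> x \<in> left_star_perp R n \<theta> C"
proof -
  have x': "x \<in> rows R n"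
    using x by (simp add: left_star_perp_def)
  have ax: "a \<odot>\<^bsub>row_module R n\<^esub> x \<in> rows R n"
    using a x' by (auto simp: row_module_def)
  have "star R n \<theta> (a \<odot>\<^bsub>row_module R n\<^esub> x) c = \<zero>" if c: "c \<in> C" for c
  proof -
    have c': "c \<in> rows R n" using c C by blast
    have "star R n \<theta> (a \<odot>\<^bsub>row_module R n\<^esub> x) c = a \<otimes> star R n \<theta> x c"
      by (simp add: star_eq_dot_phi[OF \<theta>] ax x' c' a phi_closed[OF \<theta>] dot_smult_left)
    also have "\<dots> = \<zero>"
      using x c a by (simp add: left_star_perp_def)
    finally show ?thesis .
  qed
  with ax show ?thesis by (simp add: left_star_perp_def)
qed

lemma submodule_left_star_perp:
  assumes "\<theta> \<in> carrier (RingAut R)" and "C \<subseteq> rows R n"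
  shows "submodule (left_star_perp R n \<theta> C) R (row_module R n)"
  using subgroup_left_star_perp[OF assms] smult_closed_left_star_perp[OF assms]
  by (intro submodule.intro submodule_axioms.intro)

lemma subgroup_right_star_perp:
  assumes \<theta>: "\<theta> \<in> carrier (RingAut R)" and C: "C \<subseteq> rows R n"
  shows "subgroup (right_star_perp R n \<theta> C) (add_monoid (row_module R n))"
proof -
  interpret M: abelian_group "row_module R n"
    by (rule abelian_group_row_module) (rule ring_axioms)
  show ?thesis
    unfolding right_star_perp_def using C
    by (intro subgroup_common_kernel)
      (auto simp: subset_iff star_eq_dot_phi[OF \<theta>] phi_closed[OF \<theta>] phi_add[OF \<theta>]
        dot_closed dot_add_right)
qed

lemma left_star_perp_eq_perp_of_columns:
  assumes \<theta>: "\<theta> \<in> carrier (RingAut R)" and C: "C \<subseteq> rows R n"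
  shows "left_star_perp R n \<theta> C = perp_of_columns R n (phi R n \<theta> ` C)"
  using C by (auto simp: left_star_perp_def perp_of_columns_def star_eq_dot_phi[OF \<theta>] subset_iff)

text \<open>
  One inclusion is the formula for \<open>*\<close> alone; the other writes a vector \<open>y\<close> of \<open>C\<^sup>\<bottom>\<close> as
  \<open>\<phi>(x)\<close>, where \<open>x\<close> is the image of \<open>y\<close> under the map \<open>\<phi>\<close> of \<open>\<theta>\<^sup>-\<^sup>1\<close>.
\<close>

lemma perp_of_rows_eq_phi_image:
  assumes \<theta>: "\<theta> \<in> carrier (RingAut R)" and C: "C \<subseteq> rows R n"
  shows "perp_of_rows R n C = phi R n \<theta> ` right_star_perp R n \<theta> C"
proof
  interpret A: group "RingAut R" by (rule group_RingAut) (rule ring_axioms)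
  show "phi R n \<theta> ` right_star_perp R n \<theta> C \<subseteq> perp_of_rows R n C"
    using C by (auto simp: right_star_perp_def perp_of_rows_def star_eq_dot_phi[OF \<theta>]
        phi_closed[OF \<theta>] subset_iff)
  show "perp_of_rows R n C \<subseteq> phi R n \<theta> ` right_star_perp R n \<theta> C"
  proof
    fix y assume y: "y \<in> perp_of_rows R n C"
    then have y': "y \<in> rows R n" by (simp add: perp_of_rows_def)
    let ?x = "phi R n (inv\<^bsub>RingAut R\<^esub> \<theta>) y"
    have x: "?x \<in> rows R n" using \<theta> y' by (intro phi_closed A.inv_closed)
    have yx: "phi R n \<theta> ?x = y" by (rule phi_phi_inv[OF \<theta> y'])
    have "?x \<in> right_star_perp R n \<theta> C"
      using C y x yx
      by (auto simp: right_star_perp_def perp_of_rows_def star_eq_dot_phi[OF \<theta>] subset_iff)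
    with yx show "y \<in> phi R n \<theta> ` right_star_perp R n \<theta> C" by force
  qed
qed

lemma left_circ_perp_eq_left_star_perp_inv:
  assumes "\<theta> \<in> carrier (RingAut R)"
  shows "left_circ_perp R n \<theta> = left_star_perp R n (inv\<^bsub>RingAut R\<^esub> \<theta>)"
  by (simp add: left_circ_perp_def left_star_perp_def circ_eq_star_inv[OF assms] fun_eq_iff)

lemma right_circ_perp_eq_right_star_perp_inv:
  assumes "\<theta> \<in> carrier (RingAut R)"
  shows "right_circ_perp R n \<theta> = right_star_perp R n (inv\<^bsub>RingAut R\<^esub> \<theta>)"
  by (simp add: right_circ_perp_def right_star_perp_def circ_eq_star_inv[OF assms] fun_eq_iff)

end

lemma subset_left_right_star_perp:
  assumes "C \<subseteq> rows R n"
  shows "C \<subseteq> left_star_perp R n \<theta> (right_star_perp R n \<theta> C)"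
  using assms by (auto simp: left_star_perp_def right_star_perp_def)

lemma subset_right_left_star_perp:
  assumes "C \<subseteq> rows R n"
  shows "C \<subseteq> right_star_perp R n \<theta> (left_star_perp R n \<theta> C)"
  using assms by (auto simp: left_star_perp_def right_star_perp_def)

theorem proposition2p13:
  fixes R :: "('a, 'm) ring_scheme" and \<theta> :: "'a \<Rightarrow> 'a" and n :: nat
    and C :: "(nat \<Rightarrow> 'a) set"
  assumes "ring R"
    and "\<theta> \<in> carrier (RingAut R)"
    and "n \<ge> 1"
    and "C \<subseteq> rows R n"
  shows
    "\<comment> \<open>(1)\<close>
    submodule (left_star_perp R n \<theta> C) R (row_module R n) \<and>
    subgroup (right_star_perp R n \<theta> C) (add_monoid (row_module R n)) \<and>
    \<comment> \<open>(2)\<close>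
    (\<forall>x\<in>rows R n. \<forall>y\<in>rows R n. star R n \<theta> x y = dot R n x (phi R n \<theta> y)) \<and>
    \<comment> \<open>(3)\<close>
    C \<subseteq> left_star_perp R n \<theta> (right_star_perp R n \<theta> C) \<and>
    C \<subseteq> right_star_perp R n \<theta> (left_star_perp R n \<theta> C) \<and>
    \<comment> \<open>(3')\<close>
    C \<subseteq> left_circ_perp R n \<theta> (right_circ_perp R n \<theta> C) \<and>
    C \<subseteq> right_circ_perp R n \<theta> (left_circ_perp R n \<theta> C) \<and>
    \<comment> \<open>(4)\<close>
    left_star_perp R n \<theta> C = perp_of_columns R n (phi R n \<theta> ` C) \<and>
    perp_of_rows R n C = phi R n \<theta> ` right_star_perp R n \<theta> C \<and>
    \<comment> \<open>(4'), with the map phi belonging to the inverse automorphism\<close>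
    left_circ_perp R n \<theta> C = perp_of_columns R n (phi R n (inv\<^bsub>RingAut R\<^esub> \<theta>) ` C) \<and>
    perp_of_rows R n C = phi R n (inv\<^bsub>RingAut R\<^esub> \<theta>) ` right_circ_perp R n \<theta> C"
proof -
  interpret ring R by fact
  interpret A: group "RingAut R" by (rule group_RingAut) fact
  note \<theta> = \<open>\<theta> \<in> carrier (RingAut R)\<close> and C = \<open>C \<subseteq> rows R n\<close>
  note \<theta>' = A.inv_closed[OF \<theta>]
  show ?thesis
    unfolding left_circ_perp_eq_left_star_perp_inv[OF \<theta>]
      right_circ_perp_eq_right_star_perp_inv[OF \<theta>]
    by (intro conjI ballI submodule_left_star_perp subgroup_right_star_perp star_eq_dot_phi
        subset_left_right_star_perp subset_right_left_star_perp
        left_star_perp_eq_perp_of_columns perp_of_rows_eq_phi_image \<theta> \<theta>' C)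
qed

end
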